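(* Let $n\geq1$ be an integer and $d$ a divisor of $n$ such that $C_{(n,d)}$ is a bicyclic skew brace. Then $C_{(nd,d)}$ is a skew brace Schur cover of $C_{(n,d)}$.
   Context: A skew brace is a triple $(A,+,\circ)$ where $(A,+)$ and $(A,\circ)$ are (not necessarily abelian) groups with $a\circ(b+c)=a\circ b-a+a\circ c$ for all $a,b,c\in A$. Both groups have the same neutral element $0$. A skew brace is bicyclic if both $(A,+)$ and $(A,\circ)$ are cyclic. For a positive integer $n$ and a divisor $d$ of $n$ such that every prime divisor of $n$ divides $d$, $C_{(n,d)}$ denotes the skew brace with underlying set $\mathbb{Z}/(n)$, usual addition, and $x\circ y=x+y+dxy$. The annihilator of a skew brace $A$ is $\mathrm{Ann}(A)=\{a\in A: -a+a\circ b=b\ \forall b\in A\}\cap Z(A,+)\cap Z(A,\circ)$. The commutator $A'$ is the additive subgroup of $A$ generated by all $a+b-a-b$ and all $-a+a\circ b-b$, $a,b\in A$. An annihilator extension of $Q$ by an abelian group $K$ is a short exact sequence of skew braces $0\to K\to E\to Q\to0$ with the image of $K$ contained in $\mathrm{Ann}(E)$ ($K$ is regarded as a skew brace with both operations equal to its group operation, and identified with its image). A Schur cover of a finite skew brace $Q$ is a skew brace $E$ for which there exists an annihilator extension $0\to K\to E\to Q\to0$ with $K\subseteq E'$ and $K\simeq M_b(Q)$. For a skew brace $Q$ and a (multiplicative) abelian group $K$, a factor set is a pair $(\alpha,\mu)$ of maps $Q\times Q\to K$ such that for all $x,y,z\in Q$: $\alpha(0,y)=\alpha(x,0)=1$,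 $\mu(0,y)=\mu(x,0)=1$, $\alpha(y,z)\alpha(x+y,z)^{-1}\alpha(x,y+z)\alpha(x,y)^{-1}=1$, $\mu(y,z)\mu(x\circ y,z)^{-1}\mu(x,y\circ z)\mu(x,y)^{-1}=1$, and $\alpha(y,z)\mu(x,y+z)\alpha(-x,x)=\mu(x,z)\alpha(x\circ y,-x)\alpha(x\circ y-x,x\circ z)\mu(x,y)$. Factor sets form a group $Z^2_b(Q,K)$ under pointwise multiplication. For $h:Q\to K$ put $\partial_+h(x,y)=h(y)h(x+y)^{-1}h(x)$ and $\partial_\circ h(x,y)=h(y)h(x\circ y)^{-1}h(x)$. Let $B^2_b(Q,K)=\{(\partial_+h,\partial_\circ h): h:Q\to K,\ h(0)=1\}$ and $H^2_b(Q,K)=Z^2_b(Q,K)/B^2_b(Q,K)$. The Schur multiplier of a finite skew brace $Q$ is $M_b(Q)=H^2_b(Q,\mathbb{C}^\times)$. *)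

theory Defs
  imports "HOL-Algebra.Algebra" Complex_Main
begin

section \<open>Skew braces\<close>

text \<open>
  A skew brace is carried by the \<open>ring\<close> record: \<open>\<oplus>\<close> is the additive operation \<open>+\<close>,
  which need not be commutative, and \<open>\<otimes>\<close> is the circle operation. Hence \<open>add_monoid A\<close> is
  the additive group, \<open>A\<close> itself, read as a monoid, is the circle group, and \<open>\<ominus>\<close> is additive
  inversion. The fields \<open>\<zero>\<close> and \<open>\<one>\<close> are the two neutral elements; that they coincide
  follows from the axioms.
\<close>

locale skew_brace =
  fixes A :: "('a, 'm) ring_scheme" (structure)
  assumes add_group: "group (add_monoid A)"
    and circ_group: "group A"
    and brace_law: "\<lbrakk>a \<in> carrier A; b \<in> carrier A; c \<in> carrier A\<rbrakk>
      \<Longrightarrow> a \<otimes> (b \<oplus> c) = ((a \<otimes> b) \<ominus> a) \<oplus> (a \<otimes> c)"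

locale bicyclic_skew_brace = skew_brace +
  assumes add_cyclic: "cyclic_group (add_monoid A)"
    and circ_cyclic: "cyclic_group A"

text \<open>The skew brace \<open>C\<^bsub>(n,d)\<^esub>\<close>. It is only meant for \<open>n \<ge> 1\<close> and \<open>d\<close> a divisor of \<open>n\<close>
  that every prime divisor of \<open>n\<close> divides. Classes modulo \<open>n\<close> are represented by
  \<open>{0..<n}\<close>.\<close>

definition C_brace :: "nat \<Rightarrow> nat \<Rightarrow> int ring" where
  "C_brace n d =
    \<lparr>carrier = carrier (integer_mod_group n),
     monoid.mult = (\<lambda>x y. (x + y + int d * x * y) mod int n),
     one = 0,
     ring.zero = \<one>\<^bsub>integer_mod_group n\<^esub>,
     ring.add = monoid.mult (integer_mod_group n)\<rparr>"

definition center :: "('a, 'm) monoid_scheme \<Rightarrow> 'a set" where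
  "center G = {z \<in> carrier G. \<forall>g \<in> carrier G. z \<otimes>\<^bsub>G\<^esub> g = g \<otimes>\<^bsub>G\<^esub> z}"

definition annihilator :: "('a, 'm) ring_scheme \<Rightarrow> 'a set" where
  "annihilator A =
    {a \<in> carrier A. \<forall>b \<in> carrier A. (\<ominus>\<^bsub>A\<^esub> a) \<oplus>\<^bsub>A\<^esub> (a \<otimes>\<^bsub>A\<^esub> b) = b}
      \<inter> center (add_monoid A) \<inter> center A"

definition brace_commutator :: "('a, 'm) ring_scheme \<Rightarrow> 'a set" where
  "brace_commutator A = generate (add_monoid A)
    ((\<Union>a \<in> carrier A. \<Union>b \<in> carrier A. {((a \<oplus>\<^bsub>A\<^esub> b) \<ominus>\<^bsub>A\<^esub> a) \<ominus>\<^bsub>A\<^esub> b})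
      \<union> (\<Union>a \<in> carrier A. \<Union>b \<in> carrier A. {((\<ominus>\<^bsub>A\<^esub> a) \<oplus>\<^bsub>A\<^esub> (a \<otimes>\<^bsub>A\<^esub> b)) \<ominus>\<^bsub>A\<^esub> b}))"


section \<open>Annihilator extensions\<close>

definition trivial_brace :: "('k, 'm) monoid_scheme \<Rightarrow> 'k ring" where
  "trivial_brace K = \<lparr>carrier = carrier K, monoid.mult = monoid.mult K, one = \<one>\<^bsub>K\<^esub>,
     ring.zero = \<one>\<^bsub>K\<^esub>, add = monoid.mult K\<rparr>"

text \<open>The exact sequence \<open>0 \<rightarrow> K \<rightarrow> E \<rightarrow> Q \<rightarrow> 0\<close> with maps \<open>i\<close> and \<open>p\<close>. The set \<open>ring_hom\<close>
  consists of the maps that preserve \<open>\<oplus>\<close>, \<open>\<otimes>\<close> and \<open>\<one>\<close>, that is, of the skew brace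
  homomorphisms.\<close>

definition annihilator_extension ::
  "('k, 'l) monoid_scheme \<Rightarrow> ('k \<Rightarrow> 'e) \<Rightarrow> ('e, 'm) ring_scheme \<Rightarrow> ('e \<Rightarrow> 'q)
    \<Rightarrow> ('q, 'n) ring_scheme \<Rightarrow> bool" where
  "annihilator_extension K i E p Q \<longleftrightarrow>
     comm_group K \<and> skew_brace E \<and> skew_brace Q
     \<and> i \<in> ring_hom (trivial_brace K) E \<and> inj_on i (carrier K)
     \<and> p \<in> ring_hom E Q \<and> p ` carrier E = carrier Q
     \<and> i ` carrier K = a_kernel E Q p
     \<and> i ` carrier K \<subseteq> annihilator E"


section \<open>Second cohomology and the Schur multiplier\<close>

text \<open>Factor sets are extensional on \<open>carrier Q \<times> carrier Q\<close>, so that equality of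
  factor sets is equality of maps on \<open>Q \<times> Q\<close>.\<close>

definition factor_sets ::
  "('q, 'n) ring_scheme \<Rightarrow> ('k, 'l) monoid_scheme \<Rightarrow> (('q \<times> 'q \<Rightarrow> 'k) \<times> ('q \<times> 'q \<Rightarrow> 'k)) set" where
  "factor_sets Q K =
    {(\<alpha>, \<mu>). \<alpha> \<in> (carrier Q \<times> carrier Q) \<rightarrow>\<^sub>E carrier K
       \<and> \<mu> \<in> (carrier Q \<times> carrier Q) \<rightarrow>\<^sub>E carrier K
       \<and> (\<forall>x \<in> carrier Q. \<alpha> (\<zero>\<^bsub>Q\<^esub>, x) = \<one>\<^bsub>K\<^esub> \<and> \<alpha> (x, \<zero>\<^bsub>Q\<^esub>) = \<one>\<^bsub>K\<^esub>
            \<and> \<mu> (\<zero>\<^bsub>Q\<^esub>, x) = \<one>\<^bsub>K\<^esub> \<and> \<mu> (x, \<zero>\<^bsub>Q\<^esub>) = \<one>\<^bsub>K\<^esub>)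
       \<and> (\<forall>x \<in> carrier Q. \<forall>y \<in> carrier Q. \<forall>z \<in> carrier Q.
            \<alpha> (y, z) \<otimes>\<^bsub>K\<^esub> inv\<^bsub>K\<^esub> \<alpha> (x \<oplus>\<^bsub>Q\<^esub> y, z)
              \<otimes>\<^bsub>K\<^esub> \<alpha> (x, y \<oplus>\<^bsub>Q\<^esub> z) \<otimes>\<^bsub>K\<^esub> inv\<^bsub>K\<^esub> \<alpha> (x, y) = \<one>\<^bsub>K\<^esub>
            \<and> \<mu> (y, z) \<otimes>\<^bsub>K\<^esub> inv\<^bsub>K\<^esub> \<mu> (x \<otimes>\<^bsub>Q\<^esub> y, z)
              \<otimes>\<^bsub>K\<^esub> \<mu> (x, y \<otimes>\<^bsub>Q\<^esub> z) \<otimes>\<^bsub>K\<^esub> inv\<^bsub>K\<^esub> \<mu> (x, y) = \<one>\<^bsub>K\<^esub>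
            \<and> \<alpha> (y, z) \<otimes>\<^bsub>K\<^esub> \<mu> (x, y \<oplus>\<^bsub>Q\<^esub> z) \<otimes>\<^bsub>K\<^esub> \<alpha> (\<ominus>\<^bsub>Q\<^esub> x, x)
              = \<mu> (x, z) \<otimes>\<^bsub>K\<^esub> \<alpha> (x \<otimes>\<^bsub>Q\<^esub> y, \<ominus>\<^bsub>Q\<^esub> x)
                \<otimes>\<^bsub>K\<^esub> \<alpha> ((x \<otimes>\<^bsub>Q\<^esub> y) \<ominus>\<^bsub>Q\<^esub> x, x \<otimes>\<^bsub>Q\<^esub> z) \<otimes>\<^bsub>K\<^esub> \<mu> (x, y))}"

definition Z2b ::
  "('q, 'n) ring_scheme \<Rightarrow> ('k, 'l) monoid_scheme
    \<Rightarrow> (('q \<times> 'q \<Rightarrow> 'k) \<times> ('q \<times> 'q \<Rightarrow> 'k)) monoid" where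
  "Z2b Q K =
    \<lparr>carrier = factor_sets Q K,
     monoid.mult = (\<lambda>(\<alpha>, \<mu>) (\<alpha>', \<mu>').
       (\<lambda>u \<in> carrier Q \<times> carrier Q. \<alpha> u \<otimes>\<^bsub>K\<^esub> \<alpha>' u,
        \<lambda>u \<in> carrier Q \<times> carrier Q. \<mu> u \<otimes>\<^bsub>K\<^esub> \<mu>' u)),
     one = (\<lambda>u \<in> carrier Q \<times> carrier Q. \<one>\<^bsub>K\<^esub>, \<lambda>u \<in> carrier Q \<times> carrier Q. \<one>\<^bsub>K\<^esub>)\<rparr>"

text \<open>The coboundary \<open>\<partial>h\<close> with respect to the operation of \<open>G\<close>: it is \<open>\<partial>\<^sub>+h\<close> for
  \<open>G = add_monoid Q\<close> and \<open>\<partial>\<^sub>\<circ>h\<close> for \<open>G = Q\<close>.\<close>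

definition coboundary ::
  "('q, 'n) monoid_scheme \<Rightarrow> ('k, 'l) monoid_scheme \<Rightarrow> ('q \<Rightarrow> 'k) \<Rightarrow> 'q \<times> 'q \<Rightarrow> 'k" where
  "coboundary G K h = (\<lambda>(x, y) \<in> carrier G \<times> carrier G.
     h y \<otimes>\<^bsub>K\<^esub> inv\<^bsub>K\<^esub> h (x \<otimes>\<^bsub>G\<^esub> y) \<otimes>\<^bsub>K\<^esub> h x)"

definition B2b ::
  "('q, 'n) ring_scheme \<Rightarrow> ('k, 'l) monoid_scheme \<Rightarrow> (('q \<times> 'q \<Rightarrow> 'k) \<times> ('q \<times> 'q \<Rightarrow> 'k)) set" where
  "B2b Q K = (\<lambda>h. (coboundary (add_monoid Q) K h, coboundary Q K h))
     ` {h \<in> carrier Q \<rightarrow> carrier K. h \<zero>\<^bsub>Q\<^esub> = \<one>\<^bsub>K\<^esub>}"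

definition H2b ::
  "('q, 'n) ring_scheme \<Rightarrow> ('k, 'l) monoid_scheme
    \<Rightarrow> (('q \<times> 'q \<Rightarrow> 'k) \<times> ('q \<times> 'q \<Rightarrow> 'k)) set monoid" where
  "H2b Q K = Z2b Q K Mod B2b Q K"

definition complex_units :: "complex monoid" where
  "complex_units = \<lparr>carrier = UNIV - {0}, monoid.mult = (*), one = 1\<rparr>"

definition schur_multiplier ::
  "('q, 'n) ring_scheme \<Rightarrow> (('q \<times> 'q \<Rightarrow> complex) \<times> ('q \<times> 'q \<Rightarrow> complex)) set monoid" where
  "schur_multiplier Q = H2b Q complex_units"

text \<open>The existential over \<open>K\<close> ranges over groups whose elements have the type of the
  elements of \<open>E\<close>. This loses nothing: \<open>K\<close> embeds in \<open>E\<close>, so it may be replaced by its image.\<close>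

definition is_schur_cover :: "('e, 'm) ring_scheme \<Rightarrow> ('q, 'n) ring_scheme \<Rightarrow> bool" where
  "is_schur_cover E Q \<longleftrightarrow> skew_brace E \<and> skew_brace Q \<and> finite (carrier Q) \<and>
     (\<exists>(K :: 'e monoid) i p. annihilator_extension K i E p Q
        \<and> i ` carrier K \<subseteq> brace_commutator E
        \<and> K \<cong> schur_multiplier Q)"

end

theory Submission
  imports Defs
begin

text \<open>
  Let \<open>Q = C\<^bsub>(n,d)\<^esub>\<close> and \<open>E = C\<^bsub>(nd,d)\<^esub>\<close>. The subgroup \<open>nE\<close> lies in the annihilator because \<open>d \<cdot> n = 0\<close> in \<open>E\<close>,
  and in the commutator because \<open>-x + x \<circ> 1 - 1 = dx\<close> and \<open>d\<close> divides \<open>n\<close>; its quotient is \<open>Q\<close>. It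
  remains to see that \<open>M\<^sub>b(Q)\<close> is cyclic of order \<open>d\<close>.

  Given a factor set \<open>(\<alpha>, \<mu>)\<close>, the additive group is cyclic and the complex units are
  divisible, so a coboundary makes \<open>\<alpha>\<close> trivial. Then \<open>\<mu>(x, _)\<close> is a character of the additive group,
  say \<open>\<mu>(x, y) = e(f(x) y)\<close> with \<open>e(k) = exp(2\<pi>ik/n)\<close>, and the cocycle relation makes \<open>f\<close> a
  crossed homomorphism from the circle group to \<open>\<int>/n\<close>. Since that group is cyclic, \<open>f(x) = cx\<close> for some \<open>c\<close>.
  The remaining coboundaries, those of additive characters \<open>h(x) = e(ax)\<close>, change \<open>c\<close> by \<open>-ad\<close>, so
  \<open>c\<close> modulo \<open>d\<close> is a complete invariant.
\<close>

subsection \<open>Factor sets with values in the complex units\<close>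

context skew_brace
begin

text \<open>The rewrites let facts about the additive group appear in the ring notation of the
  brace.\<close>

sublocale add: group "add_monoid A"
  rewrites "carrier (add_monoid A) = carrier A"
    and "monoid.mult (add_monoid A) = ring.add A"
    and "one (add_monoid A) = ring.zero A"
    and "m_inv (add_monoid A) = a_inv A"
  by (rule add_group) (simp_all add: a_inv_def)

sublocale circ: group A
  by (rule circ_group)

lemma minus_closed: "\<lbrakk>a \<in> carrier A; b \<in> carrier A\<rbrakk> \<Longrightarrow> a \<ominus> b \<in> carrier A"
  by (simp add: a_minus_def)

text \<open>The brace law at \<open>a = b = \<one>\<close>, \<open>c = \<zero>\<close> has left side
  \<open>\<one>\<close> and right side \<open>\<zero>\<close>.\<close>

lemma one_eq_zero: "\<one> = \<zero>"
proof -
  have "\<one> \<otimes> (\<one> \<oplus> \<zero>) = ((\<one> \<otimes> \<one>) \<ominus> \<one>) \<oplus> (\<one> \<otimes> \<zero>)"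
    by (rule brace_law) simp_all
  then show ?thesis
    by (simp add: a_minus_def)
qed

end

text \<open>The factor set conditions over the field \<open>complex\<close>, cleared of inverses and
  freed from extensionality, so that unrestricted maps can be multiplied and inverted
  directly.\<close>

definition is_factor_set ::
  "('q, 'n) ring_scheme \<Rightarrow> ('q \<times> 'q \<Rightarrow> complex) \<Rightarrow> ('q \<times> 'q \<Rightarrow> complex) \<Rightarrow> bool" where
  "is_factor_set Q \<alpha> \<mu> \<longleftrightarrow>
     (\<forall>x \<in> carrier Q. \<forall>y \<in> carrier Q. \<alpha> (x, y) \<noteq> 0 \<and> \<mu> (x, y) \<noteq> 0)
     \<and> (\<forall>x \<in> carrier Q. \<alpha> (\<zero>\<^bsub>Q\<^esub>, x) = 1 \<and> \<alpha> (x, \<zero>\<^bsub>Q\<^esub>) = 1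
          \<and> \<mu> (\<zero>\<^bsub>Q\<^esub>, x) = 1 \<and> \<mu> (x, \<zero>\<^bsub>Q\<^esub>) = 1)
     \<and> (\<forall>x \<in> carrier Q. \<forall>y \<in> carrier Q. \<forall>z \<in> carrier Q.
          \<alpha> (y, z) * \<alpha> (x, y \<oplus>\<^bsub>Q\<^esub> z) = \<alpha> (x \<oplus>\<^bsub>Q\<^esub> y, z) * \<alpha> (x, y)
          \<and> \<mu> (y, z) * \<mu> (x, y \<otimes>\<^bsub>Q\<^esub> z) = \<mu> (x \<otimes>\<^bsub>Q\<^esub> y, z) * \<mu> (x, y)
          \<and> \<alpha> (y, z) * \<mu> (x, y \<oplus>\<^bsub>Q\<^esub> z) * \<alpha> (\<ominus>\<^bsub>Q\<^esub> x, x)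
            = \<mu> (x, z) * \<alpha> (x \<otimes>\<^bsub>Q\<^esub> y, \<ominus>\<^bsub>Q\<^esub> x)
              * \<alpha> ((x \<otimes>\<^bsub>Q\<^esub> y) \<ominus>\<^bsub>Q\<^esub> x, x \<otimes>\<^bsub>Q\<^esub> z) * \<mu> (x, y))"

lemma carrier_complex_units [simp]: "x \<in> carrier complex_units \<longleftrightarrow> x \<noteq> 0"
  by (simp add: complex_units_def)

lemma mult_complex_units [simp]: "x \<otimes>\<^bsub>complex_units\<^esub> y = x * y"
  by (simp add: complex_units_def)

lemma one_complex_units [simp]: "\<one>\<^bsub>complex_units\<^esub> = 1"
  by (simp add: complex_units_def)

lemma comm_group_complex_units: "comm_group complex_units"
proof (rule comm_groupI)
  show "\<exists>y \<in> carrier complex_units. y \<otimes>\<^bsub>complex_units\<^esub> x = \<one>\<^bsub>complex_units\<^esub>"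
    if "x \<in> carrier complex_units" for x
    using that by (intro bexI[of _ "inverse x"]) simp_all
qed simp_all

lemma inv_complex_units [simp]: "x \<noteq> 0 \<Longrightarrow> inv\<^bsub>complex_units\<^esub> x = inverse x"
  by (rule group.inv_equality) (simp_all add: comm_group_complex_units comm_group.axioms)

context skew_brace
begin

lemma mem_factor_sets:
  "(\<alpha>, \<mu>) \<in> factor_sets A complex_units \<longleftrightarrow>
     \<alpha> \<in> extensional (carrier A \<times> carrier A) \<and> \<mu> \<in> extensional (carrier A \<times> carrier A)
     \<and> is_factor_set A \<alpha> \<mu>"
\<comment> \<open>If some value is zero, both sides are false; otherwise the inverses in the cocycle
  conditions can be cleared.\<close>
proof (cases "\<forall>x \<in> carrier A. \<forall>y \<in> carrier A. \<alpha> (x, y) \<noteq> 0 \<and> \<mu> (x, y) \<noteq> 0")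
  case True
  then have cocycle: "(a (y, z) * inverse (a (u, z)) * a (x, v) * inverse (a (x, y)) = 1)
      = (a (y, z) * a (x, v) = a (u, z) * a (x, y))"
    if "a = \<alpha> \<or> a = \<mu>" "x \<in> carrier A" "y \<in> carrier A" "z \<in> carrier A" "u \<in> carrier A"
    for a x y z u v
    using that by (auto simp: field_simps)
  from True show ?thesis
    by (simp add: factor_sets_def is_factor_set_def PiE_def Pi_def cocycle)
next
  case False
  then show ?thesis
    by (auto simp: factor_sets_def is_factor_set_def PiE_def Pi_def)
qed

lemma is_factor_set_cong:
  assumes "\<And>x y. \<lbrakk>x \<in> carrier A; y \<in> carrier A\<rbrakk> \<Longrightarrow> \<alpha> (x, y) = \<alpha>' (x, y) \<and> \<mu> (x, y) = \<mu>' (x, y)"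
  shows "is_factor_set A \<alpha> \<mu> \<longleftrightarrow> is_factor_set A \<alpha>' \<mu>'"
  using assms by (simp add: is_factor_set_def minus_closed cong: ball_cong)

lemma restrict_mem_factor_sets:
  "(restrict \<alpha> (carrier A \<times> carrier A), restrict \<mu> (carrier A \<times> carrier A))
     \<in> factor_sets A complex_units \<longleftrightarrow> is_factor_set A \<alpha> \<mu>"
  by (simp add: mem_factor_sets cong: is_factor_set_cong)

lemma is_factor_set_mult:
  assumes 1: "is_factor_set A \<alpha> \<mu>" and 2: "is_factor_set A \<alpha>' \<mu>'"
  shows "is_factor_set A (\<lambda>u. \<alpha> u * \<alpha>' u) (\<lambda>u. \<mu> u * \<mu>' u)"
proof -
  \<comment> \<open>Each condition for the product is the product of the two given equations,
    rearranged by commutativity.\<close>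
  have mult2: "(a * a') * (b * b') = (c * c') * (e * e')"
    if "a * b = c * e" "a' * b' = c' * e'" for a a' b b' c c' e e' :: complex
    using arg_cong2[OF that, of "(*)"] by (simp add: mult_ac)
  have mult3: "(a * a') * (b * b') * (c * c') = (e * e') * (f * f') * (g * g') * (i * i')"
    if "a * b * c = e * f * g * i" "a' * b' * c' = e' * f' * g' * i'"
    for a a' b b' c c' e e' f f' g g' i i' :: complex
    using arg_cong2[OF that, of "(*)"] by (simp add: mult_ac)
  show ?thesis
    unfolding is_factor_set_def
    using 1[unfolded is_factor_set_def] 2[unfolded is_factor_set_def]
    by (intro conjI ballI mult2 mult3) simp_all
qed

lemma is_factor_set_inverse:
  assumes "is_factor_set A \<alpha> \<mu>"
  shows "is_factor_set A (\<lambda>u. inverse (\<alpha> u)) (\<lambda>u. inverse (\<mu> u))"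
  using assms unfolding is_factor_set_def
  by (simp flip: inverse_mult_distrib)

lemma is_factor_set_one: "is_factor_set A (\<lambda>u. 1) (\<lambda>u. 1)"
  by (simp add: is_factor_set_def)

text \<open>The two cocycle conditions telescope by associativity. In the mixed condition everything
  cancels except the values of \<open>h\<close> at \<open>x \<otimes> (y \<oplus> z)\<close> and at
  \<open>((x \<otimes> y) \<ominus> x) \<oplus> (x \<otimes> z)\<close>, which the brace law
  identifies.\<close>

lemma is_factor_set_coboundary:
  assumes h: "\<And>x. x \<in> carrier A \<Longrightarrow> h x \<noteq> 0" and h0: "h \<zero> = 1"
  shows "is_factor_set A (\<lambda>(x, y). h y * inverse (h (x \<oplus> y)) * h x)
    (\<lambda>(x, y). h y * inverse (h (x \<otimes> y)) * h x)"
proof -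
  have zero: "x \<otimes> \<zero> = x" "\<zero> \<otimes> x = x" if "x \<in> carrier A" for x
    using that circ.r_one circ.l_one by (simp_all add: one_eq_zero)
  have "h z * inverse (h (y \<oplus> z)) * h y * (h (y \<oplus> z) * inverse (h (x \<otimes> (y \<oplus> z))) * h x)
         * (h x * inverse (h (\<ominus> x \<oplus> x)) * h (\<ominus> x))
       = h z * inverse (h (x \<otimes> z)) * h x
         * (h (\<ominus> x) * inverse (h ((x \<otimes> y) \<oplus> \<ominus> x)) * h (x \<otimes> y))
         * (h (x \<otimes> z) * inverse (h (((x \<otimes> y) \<ominus> x) \<oplus> (x \<otimes> z))) * h ((x \<otimes> y) \<ominus> x))
         * (h y * inverse (h (x \<otimes> y)) * h x)"
    if "x \<in> carrier A" "y \<in> carrier A" "z \<in> carrier A" for x y z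
    using that by (simp add: brace_law[symmetric] a_minus_def[symmetric] h h0 minus_closed field_simps)
  moreover have "h z * inverse (h (f y z)) * h y * (h (f y z) * inverse (h (f x (f y z))) * h x) =
     h z * inverse (h (f (f x y) z)) * h (f x y) * (h y * inverse (h (f x y)) * h x)"
    if "f = ring.add A \<or> f = monoid.mult A" "x \<in> carrier A" "y \<in> carrier A" "z \<in> carrier A" for x y z f
    using that by (auto simp: h add.m_assoc circ.m_assoc)
  ultimately show ?thesis
    by (simp add: is_factor_set_def h h0 zero)
qed

section \<open>The groups of factor sets and of coboundaries\<close>

lemma mult_Z2b:
  "(\<alpha>, \<mu>) \<otimes>\<^bsub>Z2b A complex_units\<^esub> (\<alpha>', \<mu>') =
     (\<lambda>u \<in> carrier A \<times> carrier A. \<alpha> u * \<alpha>' u, \<lambda>u \<in> carrier A \<times> carrier A. \<mu> u * \<mu>' u)"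
  by (simp add: Z2b_def)

lemma one_Z2b:
  "\<one>\<^bsub>Z2b A complex_units\<^esub> =
     (\<lambda>u \<in> carrier A \<times> carrier A. 1, \<lambda>u \<in> carrier A \<times> carrier A. 1)"
  by (simp add: Z2b_def)

lemma carrier_Z2b: "carrier (Z2b A K) = factor_sets A K"
  by (simp add: Z2b_def)

lemma comm_group_Z2b: "comm_group (Z2b A complex_units)"
proof (rule comm_groupI)
  fix a assume a: "a \<in> carrier (Z2b A complex_units)"
  then obtain \<alpha> \<mu> where [simp]: "a = (\<alpha>, \<mu>)"
    and "\<alpha> \<in> extensional (carrier A \<times> carrier A)" "\<mu> \<in> extensional (carrier A \<times> carrier A)"
    and fs: "is_factor_set A \<alpha> \<mu>"
    by (cases a) (auto simp: carrier_Z2b mem_factor_sets)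
  then show "\<one>\<^bsub>Z2b A complex_units\<^esub> \<otimes>\<^bsub>Z2b A complex_units\<^esub> a = a"
    by (auto simp: one_Z2b mult_Z2b extensional_def restrict_def fun_eq_iff)
  define b where "b = (\<lambda>u \<in> carrier A \<times> carrier A. inverse (\<alpha> u),
    \<lambda>u \<in> carrier A \<times> carrier A. inverse (\<mu> u))"
  have "b \<in> carrier (Z2b A complex_units)"
    unfolding b_def carrier_Z2b restrict_mem_factor_sets by (rule is_factor_set_inverse[OF fs])
  moreover have "b \<otimes>\<^bsub>Z2b A complex_units\<^esub> a = \<one>\<^bsub>Z2b A complex_units\<^esub>"
    using fs by (auto simp: b_def is_factor_set_def one_Z2b mult_Z2b intro!: restrict_ext)
  ultimately
  show "\<exists>b \<in> carrier (Z2b A complex_units). b \<otimes>\<^bsub>Z2b A complex_units\<^esub> a = \<one>\<^bsub>Z2b A complex_units\<^esub>"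
    ..
next
  show "\<one>\<^bsub>Z2b A complex_units\<^esub> \<in> carrier (Z2b A complex_units)"
    by (simp add: carrier_Z2b one_Z2b restrict_mem_factor_sets is_factor_set_one)
next
  fix a b assume ab: "a \<in> carrier (Z2b A complex_units)" "b \<in> carrier (Z2b A complex_units)"
  then show "a \<otimes>\<^bsub>Z2b A complex_units\<^esub> b \<in> carrier (Z2b A complex_units)"
    by (cases a; cases b)
      (simp add: carrier_Z2b mult_Z2b mem_factor_sets is_factor_set_mult cong: is_factor_set_cong)
  show "a \<otimes>\<^bsub>Z2b A complex_units\<^esub> b = b \<otimes>\<^bsub>Z2b A complex_units\<^esub> a"
    by (cases a; cases b) (simp add: mult_Z2b mult.commute)
  fix c
  show "(a \<otimes>\<^bsub>Z2b A complex_units\<^esub> b) \<otimes>\<^bsub>Z2b A complex_units\<^esub> c =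
      a \<otimes>\<^bsub>Z2b A complex_units\<^esub> (b \<otimes>\<^bsub>Z2b A complex_units\<^esub> c)"
    by (cases a; cases b; cases c) (simp add: mult_Z2b mult.assoc cong: restrict_cong)
qed

lemma mem_B2b:
  "b \<in> B2b A complex_units \<longleftrightarrow>
     (\<exists>h. (\<forall>x \<in> carrier A. h x \<noteq> 0) \<and> h \<zero> = 1
        \<and> b = (\<lambda>(x, y) \<in> carrier A \<times> carrier A. h y * inverse (h (x \<oplus> y)) * h x,
               \<lambda>(x, y) \<in> carrier A \<times> carrier A. h y * inverse (h (x \<otimes> y)) * h x))"
proof -
  have "coboundary (add_monoid A) complex_units h
        = (\<lambda>(x, y) \<in> carrier A \<times> carrier A. h y * inverse (h (x \<oplus> y)) * h x)"
      "coboundary A complex_units h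
        = (\<lambda>(x, y) \<in> carrier A \<times> carrier A. h y * inverse (h (x \<otimes> y)) * h x)"
    if "\<forall>x \<in> carrier A. h x \<noteq> 0" for h
    using that by (auto simp: coboundary_def restrict_def fun_eq_iff)
  then show ?thesis
    by (auto simp: B2b_def image_iff Pi_def)
qed

text \<open>Taking coboundaries is multiplicative in \<open>h\<close>, so products and inverses come
  from the pointwise product and inverse of the functions \<open>h\<close>.\<close>

lemma subgroup_B2b: "subgroup (B2b A complex_units) (Z2b A complex_units)"
proof -
  interpret Z: comm_group "Z2b A complex_units"
    by (rule comm_group_Z2b)
  show ?thesis
  proof (rule Z.subgroupI)
    show B: "B2b A complex_units \<subseteq> carrier (Z2b A complex_units)"
      by (auto simp: mem_B2b carrier_Z2b restrict_mem_factor_sets is_factor_set_coboundary)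
    show "B2b A complex_units \<noteq> {}"
      unfolding B2b_def by (auto intro: exI[of _ "\<lambda>_. 1"])
    show "a \<otimes>\<^bsub>Z2b A complex_units\<^esub> b \<in> B2b A complex_units"
      if "a \<in> B2b A complex_units" "b \<in> B2b A complex_units" for a b
    proof -
      from that obtain h k where h: "\<forall>x \<in> carrier A. h x \<noteq> 0" "h \<zero> = 1"
          "a = (\<lambda>(x, y) \<in> carrier A \<times> carrier A. h y * inverse (h (x \<oplus> y)) * h x,
               \<lambda>(x, y) \<in> carrier A \<times> carrier A. h y * inverse (h (x \<otimes> y)) * h x)"
        and k: "\<forall>x \<in> carrier A. k x \<noteq> 0" "k \<zero> = 1"
          "b = (\<lambda>(x, y) \<in> carrier A \<times> carrier A. k y * inverse (k (x \<oplus> y)) * k x,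
               \<lambda>(x, y) \<in> carrier A \<times> carrier A. k y * inverse (k (x \<otimes> y)) * k x)"
        unfolding mem_B2b by blast
      then show ?thesis
        unfolding mem_B2b
        by (intro exI[of _ "\<lambda>x. h x * k x"]) (auto simp: mult_Z2b restrict_def fun_eq_iff)
    qed
    show "inv\<^bsub>Z2b A complex_units\<^esub> a \<in> B2b A complex_units" if a: "a \<in> B2b A complex_units" for a
    proof -
      from a obtain h where h: "\<forall>x \<in> carrier A. h x \<noteq> 0" "h \<zero> = 1"
          "a = (\<lambda>(x, y) \<in> carrier A \<times> carrier A. h y * inverse (h (x \<oplus> y)) * h x,
               \<lambda>(x, y) \<in> carrier A \<times> carrier A. h y * inverse (h (x \<otimes> y)) * h x)"
        unfolding mem_B2b by blast
      define b where
        "b = (\<lambda>(x, y) \<in> carrier A \<times> carrier A.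
            inverse (h y) * inverse (inverse (h (x \<oplus> y))) * inverse (h x),
          \<lambda>(x, y) \<in> carrier A \<times> carrier A.
            inverse (h y) * inverse (inverse (h (x \<otimes> y))) * inverse (h x))"
      have b: "b \<in> B2b A complex_units"
        unfolding mem_B2b b_def using h by (intro exI[of _ "\<lambda>x. inverse (h x)"]) auto
      have "inverse r * s * inverse t * (r * inverse s * t) = 1"
        if "r \<noteq> 0" "s \<noteq> 0" "t \<noteq> 0" for r s t :: complex
        using that by (simp add: field_simps)
      then have "b \<otimes>\<^bsub>Z2b A complex_units\<^esub> a = \<one>\<^bsub>Z2b A complex_units\<^esub>"
        using h by (auto simp: b_def mult_Z2b one_Z2b restrict_def fun_eq_iff)
      with a b B show ?thesis
        using Z.inv_equality[of b a] by auto
    qed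
  qed
qed

end

text \<open>The first isomorphism theorem for the map sending \<open>k\<close> to the coset of
  \<open>\<theta> k\<close>: it is onto by \<open>onto\<close> and its kernel is generated by
  \<open>d\<close> by \<open>ker\<close>. It will identify \<open>H2b\<close> with
  \<open>G = Z2b\<close> and \<open>N = B2b\<close>.\<close>

lemma (in comm_group) integer_mod_group_iso_FactGroup:
  assumes N: "subgroup N G" and \<theta>: "\<theta> \<in> hom integer_group G" and d: "d > 0"
    and ker: "\<And>k. \<theta> k \<in> N \<longleftrightarrow> int d dvd k"
    and onto: "\<And>g. g \<in> carrier G \<Longrightarrow> \<exists>b \<in> N. \<exists>k. g = b \<otimes> \<theta> k"
  shows "integer_mod_group d \<cong> G Mod N"
proof -
  interpret N: normal N G
    by (rule subgroup_imp_normal[OF N])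
  interpret \<theta>: group_hom integer_group G \<theta>
    by (simp add: group_hom_def group_hom_axioms_def \<theta>)
  have closed: "\<theta> k \<in> carrier G" for k
    using \<theta>.hom_closed by simp
  have add: "\<theta> (k + l) = \<theta> k \<otimes> \<theta> l" for k l
    using \<theta>.hom_mult[of k l] by simp
  \<comment> \<open>One direction gives injectivity on residues, the other allows reduction modulo
    \<open>d\<close>, as needed for the homomorphism property and for surjectivity.\<close>
  have eq_iff: "N #> \<theta> k = N #> \<theta> l \<longleftrightarrow> k mod int d = l mod int d" for k l
  proof -
    have diff: "\<theta> (k - l) \<otimes> \<theta> l = \<theta> k"
      by (simp flip: add)
    show ?thesis
    proof
      assume "N #> \<theta> k = N #> \<theta> l"
      then have "\<theta> k \<in> N #> \<theta> l"
        using rcos_self[OF closed N] by metis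
      then obtain b where "b \<in> N" "\<theta> k = b \<otimes> \<theta> l"
        by (auto simp: r_coset_def)
      with diff have "\<theta> (k - l) = b"
        by (metis closed r_cancel N.mem_carrier)
      with \<open>b \<in> N\<close> show "k mod int d = l mod int d"
        unfolding mod_eq_dvd_iff ker[symmetric] by simp
    next
      assume "k mod int d = l mod int d"
      then have "\<theta> (k - l) \<in> N"
        unfolding mod_eq_dvd_iff ker[symmetric] .
      then have "\<theta> k \<in> N #> \<theta> l"
        unfolding r_coset_def using diff[symmetric] by blast
      then show "N #> \<theta> k = N #> \<theta> l"
        using repr_independence[OF _ closed N] by metis
    qed
  qed
  have "(\<lambda>k. N #> \<theta> k) \<in> iso (integer_mod_group d) (G Mod N)"
  proof (rule isoI)
    show "(\<lambda>k. N #> \<theta> k) \<in> hom (integer_mod_group d) (G Mod N)"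
    proof (rule homI)
      show "N #> \<theta> k \<in> carrier (G Mod N)" for k
        by (simp add: carrier_FactGroup closed)
      show "N #> \<theta> (k \<otimes>\<^bsub>integer_mod_group d\<^esub> l) = (N #> \<theta> k) \<otimes>\<^bsub>G Mod N\<^esub> (N #> \<theta> l)" for k l
        by (simp add: N.rcos_sum closed eq_iff add[symmetric])
    qed
    show "bij_betw (\<lambda>k. N #> \<theta> k) (carrier (integer_mod_group d)) (carrier (G Mod N))"
      unfolding bij_betw_def
    proof (intro conjI inj_onI equalityI subsetI)
      fix k l assume "k \<in> carrier (integer_mod_group d)" "l \<in> carrier (integer_mod_group d)"
        and "N #> \<theta> k = N #> \<theta> l"
      with d show "k = l"
        by (simp add: eq_iff carrier_integer_mod_group)
    next
      fix C assume "C \<in> carrier (G Mod N)"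
      then obtain g where g: "g \<in> carrier G" "C = N #> g"
        by (auto simp: carrier_FactGroup)
      then obtain b k where "b \<in> N" "g = b \<otimes> \<theta> k"
        using onto by blast
      then have "g \<in> N #> \<theta> k"
        by (auto simp: r_coset_def)
      then have "C = N #> \<theta> k"
        using repr_independence[OF _ closed N] g by metis
      also have "\<dots> = N #> \<theta> (k mod int d)"
        by (simp add: eq_iff)
      finally show "C \<in> (\<lambda>k. N #> \<theta> k) ` carrier (integer_mod_group d)"
        using d by (intro image_eqI[of _ _ "k mod int d"]) (simp_all add: carrier_integer_mod_group)
    qed (auto simp: carrier_FactGroup closed)
  qed
  then show ?thesis
    by (auto simp: is_iso_def)
qed

subsection \<open>The skew braces \<open>C\<^bsub>(n,d)\<^esub>\<close>\<close>

lemma C_brace_simps [simp]: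
  "\<zero>\<^bsub>C_brace n d\<^esub> = 0"
  "\<one>\<^bsub>C_brace n d\<^esub> = 0"
  "x \<oplus>\<^bsub>C_brace n d\<^esub> y = (x + y) mod int n"
  "x \<otimes>\<^bsub>C_brace n d\<^esub> y = (x + y + int d * x * y) mod int n"
  by (simp_all add: C_brace_def)

lemma carrier_C_brace: "n > 0 \<Longrightarrow> carrier (C_brace n d) = {0..<int n}"
  by (simp add: C_brace_def carrier_integer_mod_group)

lemma add_monoid_C_brace: "add_monoid (C_brace n d) = integer_mod_group n"
  by (rule monoid.equality) (simp_all add: C_brace_def)

lemma a_inv_C_brace [simp]:
  "x \<in> carrier (C_brace n d) \<Longrightarrow> \<ominus>\<^bsub>C_brace n d\<^esub> x = (- x) mod int n"
  unfolding a_inv_def add_monoid_C_brace by (rule inv_integer_mod_group) (simp add: C_brace_def)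

lemma circ_mod_left: "(x mod m + y + d * (x mod m) * y) mod m = (x + y + d * x * y) mod m"
  and circ_mod_right: "(x + y mod m + d * x * (y mod m)) mod m = (x + y + d * x * y) mod m"
  for m d x y :: int
  by (intro mod_add_cong mod_mult_cong; simp)+

lemma int_prime_dvd_transfer:
  fixes p :: int
  assumes primes: "\<forall>p::nat. Factorial_Ring.prime p \<and> p dvd n \<longrightarrow> p dvd d"
    and p: "Factorial_Ring.prime p" "p dvd int n"
  shows "p dvd int d"
proof -
  obtain q where q: "p = int q" "Factorial_Ring.prime q"
    using p by (metis prime_ge_0_int nonneg_int_cases prime_int_nat_transfer nat_int)
  with primes p show ?thesis
    by simp
qed

text \<open>A common prime divisor would divide \<open>d\<close>, hence \<open>1\<close>.
  Invertibility of \<open>1 + dx\<close> modulo \<open>n\<close> is what yields circle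
  inverses.\<close>

lemma coprime_one_plus_mult:
  fixes x :: int
  assumes "n > 0" and primes: "\<forall>p::nat. Factorial_Ring.prime p \<and> p dvd n \<longrightarrow> p dvd d"
  shows "coprime (1 + int d * x) (int n)"
proof (rule ccontr)
  assume "\<not> coprime (1 + int d * x) (int n)"
  then obtain p where p: "Factorial_Ring.prime p" "p dvd 1 + int d * x" "p dvd int n"
    using \<open>n > 0\<close> prime_factor_int[of "gcd (1 + int d * x) (int n)"]
    by (auto simp: coprime_iff_gcd_eq_1)
  with primes have "p dvd int d"
    by (blast intro: int_prime_dvd_transfer)
  with p have "p dvd 1"
    by (metis dvd_add_left_iff dvd_mult2)
  with p show False
    by (meson not_prime_unit)
qed

lemma skew_brace_C_brace:
  assumes n: "n > 0" and primes: "\<forall>p::nat. Factorial_Ring.prime p \<and> p dvd n \<longrightarrow> p dvd d"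
  shows "skew_brace (C_brace n d)"
proof (rule skew_brace.intro)
  show "group (add_monoid (C_brace n d))"
    unfolding add_monoid_C_brace by (rule group_integer_mod_group)
  show "group (C_brace n d)"
  proof (rule groupI)
    fix x y z assume "x \<in> carrier (C_brace n d)"
    show "(x \<otimes>\<^bsub>C_brace n d\<^esub> y) \<otimes>\<^bsub>C_brace n d\<^esub> z = x \<otimes>\<^bsub>C_brace n d\<^esub> (y \<otimes>\<^bsub>C_brace n d\<^esub> z)"
      by (simp add: circ_mod_left circ_mod_right) (simp add: algebra_simps)
    \<comment> \<open>The equation \<open>y + x + dyx = 0\<close> reads
      \<open>y (1 + dx) = -x\<close>, so the circle inverse of \<open>x\<close> is
      \<open>- x * u\<close> with \<open>u\<close> inverse to \<open>1 + dx\<close> modulo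
      \<open>n\<close>.\<close>
    obtain u v where "u * (1 + int d * x) + v * int n = 1"
      using bezout_int[of "1 + int d * x" "int n"] coprime_one_plus_mult[OF n primes] by auto
    then have "1 - u * (1 + int d * x) = v * int n"
      by linarith
    moreover have "(- x * u) + x + int d * (- x * u) * x = x * (1 - u * (1 + int d * x))"
      by (simp add: algebra_simps)
    ultimately have "(- x * u) + x + int d * (- x * u) * x = int n * (v * x)"
      by (simp add: mult_ac)
    then have "((- x * u) mod int n) \<otimes>\<^bsub>C_brace n d\<^esub> x = \<one>\<^bsub>C_brace n d\<^esub>"
      by (simp only: C_brace_simps circ_mod_left mod_mult_self1_is_0)
    moreover have "(- x * u) mod int n \<in> carrier (C_brace n d)"
      using n by (simp add: carrier_C_brace)
    ultimately show "\<exists>y \<in> carrier (C_brace n d). y \<otimes>\<^bsub>C_brace n d\<^esub> x = \<one>\<^bsub>C_brace n d\<^esub>"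
      by blast
  qed (use n in \<open>simp_all add: carrier_C_brace\<close>)
  show "a \<otimes>\<^bsub>C_brace n d\<^esub> (b \<oplus>\<^bsub>C_brace n d\<^esub> c) =
      ((a \<otimes>\<^bsub>C_brace n d\<^esub> b) \<ominus>\<^bsub>C_brace n d\<^esub> a) \<oplus>\<^bsub>C_brace n d\<^esub> (a \<otimes>\<^bsub>C_brace n d\<^esub> c)"
    if "a \<in> carrier (C_brace n d)" for a b c
    using that by (simp add: a_minus_def mod_simps circ_mod_right) (simp add: algebra_simps)
qed

lemma annihilator_extension_C_brace:
  assumes n: "n > 0" and "d dvd n"
    and primes: "\<forall>p::nat. Factorial_Ring.prime p \<and> p dvd n \<longrightarrow> p dvd d"
  shows "annihilator_extension (integer_mod_group d) (\<lambda>k. int n * k)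
    (C_brace (n * d) d) (\<lambda>x. x mod int n) (C_brace n d)"
proof -
  have d: "d > 0"
    using n \<open>d dvd n\<close> by (auto intro: Nat.gr0I)
  have nd: "n * d > 0"
    using n d by simp
  \<comment> \<open>A prime dividing \<open>n * d\<close> divides \<open>n\<close> or
    \<open>d\<close>, so the larger brace inherits the condition on primes.\<close>
  have "\<forall>p::nat. Factorial_Ring.prime p \<and> p dvd n * d \<longrightarrow> p dvd d"
    using primes by (auto simp: prime_dvd_mult_iff)
  then have E: "skew_brace (C_brace (n * d) d)"
    by (rule skew_brace_C_brace[OF nd])
  have modn: "a mod (int n * int d) mod int n = a mod int n" for a
    by (simp add: mod_mod_cancel)
  have image: "(\<lambda>k. int n * k) ` {0..<int d} = {x \<in> {0..<int n * int d}. x mod int n = 0}"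
  proof (intro equalityI subsetI)
    fix x assume x: "x \<in> {x \<in> {0..<int n * int d}. x mod int n = 0}"
    then obtain k where k: "x = int n * k"
      by (auto elim: dvdE)
    with x n show "x \<in> (\<lambda>k. int n * k) ` {0..<int d}"
      by (auto simp: zero_le_mult_iff)
  qed (use n in auto)
  \<comment> \<open>The cross term is a multiple of \<open>nd\<close>, so the circle operation with
    a multiple of \<open>n\<close> is addition. Both the annihilator property and the homomorphism
    property of the embedding follow.\<close>
  have circ: "(int n * k + b + int d * (int n * k) * b) mod (int n * int d) =
      (int n * k + b) mod (int n * int d)" for k b
  proof -
    have "int n * k + b + int d * (int n * k) * b = (int n * k + b) + (int n * int d) * (k * b)"
      by (simp add: algebra_simps)
    then show ?thesis
      by (metis mod_mult_self2)
  qed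
  have circ': "(b + int n * k + int d * b * (int n * k)) mod (int n * int d) =
      (int n * k + b) mod (int n * int d)" for k b
    using circ[of k b] by (simp add: algebra_simps)
  have annihilator: "int n * k \<in> annihilator (C_brace (n * d) d)" if k: "k \<in> {0..<int d}" for k
  proof -
    have nk: "int n * k \<in> carrier (C_brace (n * d) d)"
      using k n nd by (simp add: carrier_C_brace)
    then have "\<ominus>\<^bsub>C_brace (n * d) d\<^esub> (int n * k) \<oplus>\<^bsub>C_brace (n * d) d\<^esub> (int n * k \<otimes>\<^bsub>C_brace (n * d) d\<^esub> b) = b"
      if "b \<in> carrier (C_brace (n * d) d)" for b
      using that nd by (simp add: circ mod_simps) (simp add: carrier_C_brace)
    moreover have "int n * k \<in> center (add_monoid (C_brace (n * d) d))"
      using nk by (simp add: center_def add.commute)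
    moreover have "int n * k \<in> center (C_brace (n * d) d)"
      using nk by (simp add: center_def circ circ')
    ultimately show ?thesis
      using nk by (simp add: annihilator_def)
  qed
  have "(\<lambda>k. int n * k) \<in> ring_hom (trivial_brace (integer_mod_group d)) (C_brace (n * d) d)"
    using n d nd unfolding ring_hom_def
    by (auto simp: trivial_brace_def carrier_integer_mod_group carrier_C_brace circ mult_mod_right
        distrib_left)
  moreover have "(\<lambda>x. x mod int n) \<in> ring_hom (C_brace (n * d) d) (C_brace n d)"
    using n d nd unfolding ring_hom_def
    by (auto simp: carrier_C_brace modn circ_mod_left circ_mod_right mod_add_eq)
  moreover have "(\<lambda>x. x mod int n) ` carrier (C_brace (n * d) d) = carrier (C_brace n d)"
  proof (intro equalityI subsetI)
    fix x assume x: "x \<in> carrier (C_brace n d)"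
    have "int n \<le> int n * int d"
      using d n by (simp add: mult_le_cancel_left1)
    with x n have "0 \<le> x" "x < int n" "x < int n * int d"
      by (auto simp only: carrier_C_brace atLeastLessThan_iff intro: less_le_trans)
    with nd show "x \<in> (\<lambda>x. x mod int n) ` carrier (C_brace (n * d) d)"
      by (intro image_eqI[of _ _ x]) (simp_all add: carrier_C_brace)
  qed (use n in \<open>auto simp: carrier_C_brace\<close>)
  moreover have "(\<lambda>k. int n * k) ` carrier (integer_mod_group d) =
      a_kernel (C_brace (n * d) d) (C_brace n d) (\<lambda>x. x mod int n)"
    using d nd by (simp add: a_kernel_def kernel_def carrier_C_brace carrier_integer_mod_group image)
  moreover have "inj_on (\<lambda>k. int n * k) (carrier (integer_mod_group d))"
    using n by (auto simp: inj_on_def)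
  moreover have "(\<lambda>k. int n * k) ` carrier (integer_mod_group d) \<subseteq> annihilator (C_brace (n * d) d)"
    using annihilator d by (auto simp: carrier_integer_mod_group)
  ultimately show ?thesis
    using E skew_brace_C_brace[OF n primes] by (simp add: annihilator_extension_def)
qed

lemma mult_mem_brace_commutator_C_brace:
  assumes m: "m > 0"
  shows "(int d * x) mod int m \<in> brace_commutator (C_brace m d)"
\<comment> \<open>For \<open>m = 1\<close> the integer \<open>1\<close> is not a representative, and
  the claim is only about the neutral element.\<close>
proof (cases "m = 1")
  case True
  then show ?thesis
    unfolding brace_commutator_def using generate.one[of "add_monoid (C_brace m d)"] by simp
next
  case False
  with m have 1: "1 \<in> carrier (C_brace m d)"
    by (simp add: carrier_C_brace)
  define y where "y = x mod int m"
  have y: "y \<in> carrier (C_brace m d)"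
    using m by (simp add: y_def carrier_C_brace)
  define c where "c = ((\<ominus>\<^bsub>C_brace m d\<^esub> y) \<oplus>\<^bsub>C_brace m d\<^esub> (y \<otimes>\<^bsub>C_brace m d\<^esub> 1)) \<ominus>\<^bsub>C_brace m d\<^esub> 1"
  have "c \<in> brace_commutator (C_brace m d)"
    unfolding brace_commutator_def c_def using 1 y by (blast intro: generate.incl)
  moreover have "c = (int d * y) mod int m"
    using 1 y by (simp add: c_def a_minus_def mod_simps)
  ultimately show ?thesis
    by (simp add: y_def mod_simps)
qed

subsection \<open>Characters and cocycles of finite cyclic groups\<close>

text \<open>The character \<open>e\<close> of the overview, defined on all integers so that
  exponents can be computed without reduction modulo \<open>n\<close>.\<close>

definition root_char :: "nat \<Rightarrow> int \<Rightarrow> complex" where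
  "root_char n k = cis (2 * pi * of_int k / of_nat n)"

lemma root_char_0 [simp]: "root_char n 0 = 1"
  by (simp add: root_char_def)

lemma root_char_nonzero [simp]: "root_char n k \<noteq> 0"
  by (simp add: root_char_def)

lemma root_char_add: "root_char n (k + l) = root_char n k * root_char n l"
  by (simp add: root_char_def cis_mult ring_distribs add_divide_distrib)

lemma root_char_minus: "root_char n (- k) = inverse (root_char n k)"
  using root_char_add[of n k "- k"] by (simp add: field_simps)

lemma root_char_diff: "root_char n (k - l) = root_char n k * inverse (root_char n l)"
  using root_char_add[of n k "- l"] by (simp add: root_char_minus)

lemma root_char_power: "root_char n k ^ m = root_char n (k * int m)"
  by (simp add: root_char_def DeMoivre mult_ac)

lemma root_char_eq_1_iff:
  assumes "n > 0"
  shows "root_char n k = 1 \<longleftrightarrow> int n dvd k"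
proof
  assume "root_char n k = 1"
  \<comment> \<open>The real part decides: a cosine equal to 1 forces a multiple of
    \<open>2 * pi\<close>.\<close>
  then have "cos (2 * pi * of_int k / of_nat n) = 1"
    by (metis root_char_def cis.sel(1) one_complex.sel(1))
  then obtain m where "2 * pi * of_int k / of_nat n = of_int m * 2 * pi"
    by (auto simp: cos_one_2pi_int)
  with assms have "(of_int k :: real) = of_int (m * int n)"
    by (simp add: field_simps)
  then have "k = m * int n"
    by (simp only: of_int_eq_iff)
  then show "int n dvd k"
    by simp
next
  assume "int n dvd k"
  then obtain m where "k = int n * m" ..
  with assms show "root_char n k = 1"
    using cis_multiple_2pi[of "of_int m"] by (simp add: root_char_def mult_ac)
qed

lemma root_char_eq_iff:
  assumes "n > 0"
  shows "root_char n k = root_char n l \<longleftrightarrow> k mod int n = l mod int n"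
proof -
  have "root_char n k = root_char n l \<longleftrightarrow> root_char n (k - l) = 1"
    by (simp add: root_char_diff field_simps)
  then show ?thesis
    by (simp add: root_char_eq_1_iff[OF assms] mod_eq_dvd_iff)
qed

lemma root_of_unity_is_root_char:
  assumes "n > 0" "z ^ n = 1"
  obtains k where "z = root_char n k"
proof -
  from assms bij_betw_roots_unity[OF \<open>n > 0\<close>]
  have "z \<in> (\<lambda>k. cis (2 * pi * real k / real n)) ` {..<n}"
    by (simp add: bij_betw_def)
  then obtain k where "z = root_char n (int k)"
    by (auto simp: root_char_def)
  then show ?thesis
    by (rule that)
qed

lemma character_of_cyclic_is_root_char:
  fixes f :: "int \<Rightarrow> complex"
  assumes n: "n > 0" and f0: "f 0 = 1"
    and mult: "\<And>x y. \<lbrakk>x \<in> {0..<int n}; y \<in> {0..<int n}\<rbrakk> \<Longrightarrow> f ((x + y) mod int n) = f x * f y"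
  obtains k where "\<And>x. x \<in> {0..<int n} \<Longrightarrow> f x = root_char n (k * x)"
proof -
  \<comment> \<open>The value at the generator determines \<open>f\<close>, and \<open>m = n\<close>
    shows that this value is an \<open>n\<close>-th root of unity. Writing
    \<open>1 mod int n\<close> covers \<open>n = 1\<close>.\<close>
  have power: "f (int m mod int n) = f (1 mod int n) ^ m" for m
  proof (induction m)
    case (Suc m)
    then show ?case
      using mult[of "1 mod int n" "int m mod int n"] n by (simp add: mod_simps)
  qed (use f0 in simp)
  with f0 have "f (1 mod int n) ^ n = 1"
    using power[of n] by simp
  then obtain k where k: "f (1 mod int n) = root_char n k"
    using root_of_unity_is_root_char[OF n] by metis
  have "f x = root_char n (k * x)" if "x \<in> {0..<int n}" for x
    using power[of "nat x"] that by (simp add: k root_char_power)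
  then show ?thesis
    by (rule that)
qed

text \<open>Vanishing of \<open>H\<^sup>2(\<int>/n, \<complex>\<^sup>\<times>)\<close>: the cocycle relation at \<open>(1, x, y)\<close> determines \<open>\<alpha>\<close> from the
  values \<open>\<alpha> (1, i)\<close>, and an \<open>n\<close>-th root of their product makes the resulting \<open>h\<close> periodic.\<close>

lemma cocycle_of_cyclic_is_coboundary:
  fixes \<alpha> :: "int \<times> int \<Rightarrow> complex"
  assumes n: "n > 0"
    and nz: "\<And>x y. \<lbrakk>x \<in> {0..<int n}; y \<in> {0..<int n}\<rbrakk> \<Longrightarrow> \<alpha> (x, y) \<noteq> 0"
    and norm: "\<And>x. x \<in> {0..<int n} \<Longrightarrow> \<alpha> (0, x) = 1 \<and> \<alpha> (x, 0) = 1"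
    and cocycle: "\<And>x y z. \<lbrakk>x \<in> {0..<int n}; y \<in> {0..<int n}; z \<in> {0..<int n}\<rbrakk> \<Longrightarrow>
      \<alpha> (y, z) * \<alpha> (x, (y + z) mod int n) = \<alpha> ((x + y) mod int n, z) * \<alpha> (x, y)"
  obtains h where "h 0 = 1" "\<And>x. x \<in> {0..<int n} \<Longrightarrow> h x \<noteq> 0"
    "\<And>x y. \<lbrakk>x \<in> {0..<int n}; y \<in> {0..<int n}\<rbrakk> \<Longrightarrow>
      \<alpha> (x, y) = h y * inverse (h ((x + y) mod int n)) * h x"
proof -
  \<comment> \<open>Natural indices permit induction, and \<open>a\<close> is periodic in both
    arguments.\<close>
  define a where "a i j = \<alpha> (int i mod int n, int j mod int n)" for i j
  have a_nz: "a i j \<noteq> 0" and a_0: "a 0 i = 1" "a i 0 = 1" for i j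
    using n by (auto simp: a_def nz norm)
  have a_cocycle: "a j k * a i (j + k) = a (i + j) k * a i j" for i j k
    using n cocycle[of "int i mod int n" "int j mod int n" "int k mod int n"]
    by (simp add: a_def mod_simps)
  define P where "P m = (\<Prod>i<m. a 1 i)" for m
  have P_nz: "P m \<noteq> 0" for m
    by (auto simp: P_def a_nz)
  have "{z. z ^ n = P n} \<noteq> {}"
    using card_nth_roots[OF P_nz n] n by (metis card.empty less_irrefl)
  then obtain \<zeta> where \<zeta>: "\<zeta> ^ n = P n"
    by auto
  with P_nz n have \<zeta>_nz: "\<zeta> \<noteq> 0"
    by (metis power_eq_0_iff)
  define h where "h m = \<zeta> ^ m / P m" for m
  have h_nz: "h m \<noteq> 0" for m
    by (simp add: h_def \<zeta>_nz P_nz)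
  \<comment> \<open>This is the coboundary equation at \<open>(1, m)\<close>, since
    \<open>h 1 = \<zeta>\<close>.\<close>
  have h_Suc: "h (Suc m) * a 1 m = h m * \<zeta>" for m
    using P_nz[of m] a_nz[of 1 m] by (simp add: h_def P_def field_simps)
  have h_0: "h 0 = 1"
    by (simp add: h_def P_def)
  have "h (n + m) = h m" for m
  proof (induction m)
    case 0
    then show ?case
      using P_nz[of n] by (simp add: h_0) (simp add: h_def \<zeta>)
  next
    case (Suc m)
    have "a 1 (n + m) = a 1 m"
      by (simp add: a_def)
    with Suc h_Suc[of "n + m"] h_Suc[of m] a_nz[of 1 m] show ?case
      by (metis add_Suc_right mult_right_cancel)
  qed
  then have "h (n * q + m) = h m" for m q
    by (induction q) (simp_all add: add.assoc)
  then have h_mod: "h (m mod n) = h m" for m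
    by (metis mult_div_mod_eq)
  have a_h: "a i j * h (i + j) = h j * h i" for i j
  proof (induction i)
    case 0
    then show ?case
      by (simp add: a_0 h_0)
  next
    case (Suc i)
    \<comment> \<open>The cocycle relation at \<open>(1, i, j)\<close>. The claim is then multiplied
      by \<open>a 1 i * a 1 (i + j)\<close>, so that this relation and \<open>h_Suc\<close> apply
      without division; the factor cancels at the end.\<close>
    have "a i j * a 1 (i + j) = a (Suc i) j * a 1 i"
      using a_cocycle[of i j 1] by simp
    then have "a (Suc i) j * h (Suc i + j) * (a 1 i * a 1 (i + j))
        = (a i j * a 1 (i + j)) * h (Suc (i + j)) * a 1 (i + j)"
      by simp
    also have "\<dots> = a i j * (h (Suc (i + j)) * a 1 (i + j)) * a 1 (i + j)"
      by (simp add: mult_ac)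
    also have "\<dots> = (a i j * h (i + j)) * \<zeta> * a 1 (i + j)"
      using h_Suc[of "i + j"] by (simp add: mult_ac)
    also have "\<dots> = h j * (h i * \<zeta>) * a 1 (i + j)"
      by (simp add: Suc.IH mult_ac)
    also have "\<dots> = h j * h (Suc i) * (a 1 i * a 1 (i + j))"
      using h_Suc[of i] by (simp add: mult_ac)
    finally show ?case
      using a_nz by simp
  qed
  show ?thesis
  proof (rule that[of "\<lambda>x. h (nat x)"])
    fix x y assume xy: "x \<in> {0..<int n}" "y \<in> {0..<int n}"
    then have "h (nat ((x + y) mod int n)) = h (nat x + nat y)"
      using h_mod[of "nat x + nat y"] by (simp add: nat_mod_distrib nat_add_distrib)
    moreover have "\<alpha> (x, y) = a (nat x) (nat y)"
      using xy by (simp add: a_def)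
    ultimately show "\<alpha> (x, y) = h (nat y) * inverse (h (nat ((x + y) mod int n))) * h (nat x)"
      using a_h[of "nat x" "nat y"] h_nz by (simp add: field_simps)
  qed (simp_all add: h_0 h_nz)
qed

subsection \<open>The Schur multiplier of a bicyclic \<open>C\<^bsub>(n,d)\<^esub>\<close>\<close>

text \<open>The relation \<open>f (x \<circ> y) = f y + (1 + dy) f x\<close> says that \<open>f\<close> is a crossed homomorphism from the circle
  group, on which \<open>y\<close> acts through the unit \<open>1 + dy\<close>; so is \<open>x \<mapsto> cx\<close>. A generator \<open>g\<close> of
  the circle group is prime to \<open>n\<close>, since \<open>\<circ>\<close> and \<open>+\<close> agree modulo the primes dividing \<open>n\<close>,
  and hence the two agree at \<open>g\<close> for some \<open>c\<close>.\<close>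

lemma crossed_hom_C_brace_linear:
  fixes f :: "int \<Rightarrow> int"
  assumes n: "n > 0" and primes: "\<forall>p::nat. Factorial_Ring.prime p \<and> p dvd n \<longrightarrow> p dvd d"
    and bicyclic: "bicyclic_skew_brace (C_brace n d)"
    and f: "\<And>x y. \<lbrakk>x \<in> {0..<int n}; y \<in> {0..<int n}\<rbrakk> \<Longrightarrow>
      f ((x + y + int d * x * y) mod int n) mod int n = (f y + f x * (1 + int d * y)) mod int n"
  obtains c where "\<And>x. x \<in> {0..<int n} \<Longrightarrow> f x mod int n = (c * x) mod int n"
proof -
  interpret bicyclic_skew_brace "C_brace n d"
    by (rule bicyclic)
  have carrier: "carrier (C_brace n d) = {0..<int n}"
    by (rule carrier_C_brace[OF n])
  obtain g where g: "g \<in> {0..<int n}"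
    and gen: "subgroup_generated (C_brace n d) {g} = C_brace n d"
    using circ_cyclic by (auto simp: cyclic_group_def carrier)
  \<comment> \<open>Induction along the circle group: the elements satisfying \<open>P\<close> form
    a subgroup containing the generator \<open>g\<close>, hence are all elements.\<close>
  have induct: "P x" if x: "x \<in> {0..<int n}" and Pg: "P g" and P0: "P 0"
    and P_circ: "\<And>x y. \<lbrakk>x \<in> {0..<int n}; y \<in> {0..<int n}; P x; P y\<rbrakk> \<Longrightarrow>
      P ((x + y + int d * x * y) mod int n)"
    and P_inv: "\<And>x y. \<lbrakk>x \<in> {0..<int n}; y \<in> {0..<int n}; P x;
      (x + y + int d * x * y) mod int n = 0\<rbrakk> \<Longrightarrow> P y"
    for P x
  proof -
    have "subgroup {x \<in> {0..<int n}. P x} (C_brace n d)"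
    proof (rule circ.subgroupI)
      fix a assume a: "a \<in> {x \<in> {0..<int n}. P x}"
      then have "inv\<^bsub>C_brace n d\<^esub> a \<in> {0..<int n}"
        using circ.inv_closed[of a] by (simp add: carrier)
      moreover have "(a + inv\<^bsub>C_brace n d\<^esub> a + int d * a * inv\<^bsub>C_brace n d\<^esub> a) mod int n = 0"
        using circ.r_inv[of a] a by (simp add: carrier)
      ultimately show "inv\<^bsub>C_brace n d\<^esub> a \<in> {x \<in> {0..<int n}. P x}"
        using a P_inv[of a "inv\<^bsub>C_brace n d\<^esub> a"] by simp
      show "a \<otimes>\<^bsub>C_brace n d\<^esub> b \<in> {x \<in> {0..<int n}. P x}" if "b \<in> {x \<in> {0..<int n}. P x}" for b
        using P_circ[of a b] a that n by simp
    next
      show "{x \<in> {0..<int n}. P x} \<noteq> {}"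
        using g Pg by blast
    qed (auto simp: carrier)
    then have "generate (C_brace n d) {g} \<subseteq> {x \<in> {0..<int n}. P x}"
      using g Pg by (intro circ.generate_subgroup_incl) auto
    moreover have "generate (C_brace n d) {g} = {0..<int n}"
      using arg_cong[OF gen, of carrier] g by (simp add: carrier_subgroup_generated carrier)
    ultimately show ?thesis
      using x by blast
  qed
  have "coprime g (int n)"
  proof (rule ccontr)
    assume "\<not> coprime g (int n)"
    then obtain p where p: "Factorial_Ring.prime p" "p dvd g" "p dvd int n"
      using n prime_factor_int[of "gcd g (int n)"] by (auto simp: coprime_iff_gcd_eq_1)
    with primes have pd: "p dvd int d"
      by (blast intro: int_prime_dvd_transfer)
    \<comment> \<open>As \<open>p\<close> divides \<open>g\<close>, \<open>n\<close> and
      \<open>d\<close>, divisibility by \<open>p\<close> spreads from \<open>g\<close> to every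
      element, in particular to the class of 1.\<close>
    have "p dvd 1 mod int n"
    proof (rule induct)
      show "p dvd (x + y + int d * x * y) mod int n" if "p dvd x" "p dvd y" for x y
        using that p by (simp add: dvd_mod)
      show "p dvd y" if "p dvd x" "(x + y + int d * x * y) mod int n = 0" for x y
      proof -
        have "p dvd x + y + int d * x * y"
          using that(2) p(3) by (meson dvd_trans mod_0_imp_dvd)
        then have "p dvd (x + y) + int d * (x * y)"
          by (simp add: mult.assoc)
        with pd have "p dvd x + y"
          by (simp add: dvd_add_left_iff)
        with \<open>p dvd x\<close> show ?thesis
          by (simp add: dvd_add_right_iff)
      qed
    qed (use n p in auto)
    with p(3) have "p dvd 1"
      by (simp add: dvd_mod_iff)
    with p(1) show False
      by (meson not_prime_unit)
  qed
  then obtain u v where uv: "u * g + v * int n = 1"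
    using bezout_int[of g "int n"] by auto
  \<comment> \<open>Since \<open>u\<close> inverts \<open>g\<close> modulo \<open>n\<close>, this
    choice solves \<open>c * g = f g\<close> modulo \<open>n\<close>.\<close>
  define c where "c = f g * u"
  have "f 0 mod int n = (f 0 + f 0) mod int n"
    using f[of 0 0] n by simp
  then have "int n dvd f 0"
    by (simp add: mod_eq_dvd_iff)
  then have f0: "f 0 mod int n = (c * 0) mod int n"
    by simp
  have "f x mod int n = (c * x) mod int n" if "x \<in> {0..<int n}" for x
    using that
  proof (rule induct)
    have "f g = f g * (u * g + v * int n)"
      by (simp add: uv)
    then have "f g - c * g = int n * (f g * v)"
      by (simp add: c_def algebra_simps)
    then show "f g mod int n = (c * g) mod int n"
      by (simp add: mod_eq_dvd_iff)
  next
    fix x y assume xy: "x \<in> {0..<int n}" "y \<in> {0..<int n}"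
      and x: "f x mod int n = (c * x) mod int n"
    have *: "f ((x + y + int d * x * y) mod int n) mod int n =
        (f y + c * x * (1 + int d * y)) mod int n"
      unfolding f[OF xy] using x by (intro mod_add_cong mod_mult_cong) simp_all
    {
      assume "f y mod int n = (c * y) mod int n"
      then have "(f y + c * x * (1 + int d * y)) mod int n =
          (c * y + c * x * (1 + int d * y)) mod int n"
        by (intro mod_add_cong) simp_all
      also have "c * y + c * x * (1 + int d * y) = c * (x + y + int d * x * y)"
        by (simp add: algebra_simps)
      finally show "f ((x + y + int d * x * y) mod int n) mod int n =
          (c * ((x + y + int d * x * y) mod int n)) mod int n"
        by (simp add: * mod_simps)
    next
      \<comment> \<open>For a circle inverse, \<open>f 0 = 0\<close> modulo \<open>n\<close> gives a
        first multiple of \<open>n\<close>; subtracting \<open>c\<close> times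
        \<open>x \<circ> y\<close> leaves exactly \<open>f y - c * y\<close>.\<close>
      assume 0: "(x + y + int d * x * y) mod int n = 0"
      then have "int n dvd f y + c * x * (1 + int d * y)"
        using * f0 by (simp add: mod_0_imp_dvd)
      moreover have "int n dvd c * (x + y + int d * x * y)"
        using 0 by (simp add: mod_0_imp_dvd)
      ultimately have "int n dvd (f y + c * x * (1 + int d * y)) - c * (x + y + int d * x * y)"
        by (rule dvd_diff)
      also have "(f y + c * x * (1 + int d * y)) - c * (x + y + int d * x * y) = f y - c * y"
        by (simp add: algebra_simps)
      finally show "f y mod int n = (c * y) mod int n"
        by (simp add: mod_eq_dvd_iff)
    }
  qed (rule f0)
  then show ?thesis
    by (rule that)
qed

section \<open>Bilinear factor sets as representatives of the cohomology classes\<close>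

lemma root_char_mult_mod [simp]:
  assumes "n > 0"
  shows "root_char n (k * (x mod int n)) = root_char n (k * x)"
    and "root_char n (k * ((x mod int n) * y)) = root_char n (k * (x * y))"
    and "root_char n (k * (x * (y mod int n))) = root_char n (k * (x * y))"
  unfolding root_char_eq_iff[OF assms] by (intro mod_mult_cong; simp)+

text \<open>The normal form of the overview, with \<open>f(x) = kx\<close>. The parameter ranges
  over all integers so that the family is a homomorphism on \<open>integer_group\<close>.\<close>

definition bilinear_factor_set ::
    "nat \<Rightarrow> nat \<Rightarrow> int \<Rightarrow> (int \<times> int \<Rightarrow> complex) \<times> (int \<times> int \<Rightarrow> complex)" where
  "bilinear_factor_set n d k =
     (\<lambda>u \<in> carrier (C_brace n d) \<times> carrier (C_brace n d). 1,
      \<lambda>u \<in> carrier (C_brace n d) \<times> carrier (C_brace n d). root_char n (k * (fst u * snd u)))"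

text \<open>The mixed condition is additivity of \<open>xy\<close> in \<open>y\<close>. In the
  circle cocycle condition both exponents equal \<open>k (xy + xz + yz + dxyz)\<close>.\<close>

lemma bilinear_factor_set_hom:
  assumes n: "n > 0" and brace: "skew_brace (C_brace n d)"
  shows "bilinear_factor_set n d \<in> hom integer_group (Z2b (C_brace n d) complex_units)"
proof (rule homI)
  interpret skew_brace "C_brace n d"
    by (rule brace)
  fix k
  have "root_char n (k * (y * z)) * root_char n (k * (x * (y + z + int d * y * z)))
      = root_char n (k * ((x + y + int d * x * y) * z)) * root_char n (k * (x * y))" for x y z
    unfolding root_char_add[symmetric] by (simp add: algebra_simps)
  moreover have "root_char n (k * (x * (y + z))) =
      root_char n (k * (x * z)) * root_char n (k * (x * y))" for x y z
    unfolding root_char_add[symmetric] by (simp add: algebra_simps)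
  ultimately have "is_factor_set (C_brace n d) (\<lambda>u. 1) (\<lambda>u. root_char n (k * (fst u * snd u)))"
    using n by (simp add: is_factor_set_def)
  then show "bilinear_factor_set n d k \<in> carrier (Z2b (C_brace n d) complex_units)"
    by (simp add: bilinear_factor_set_def carrier_Z2b restrict_mem_factor_sets)
  show "bilinear_factor_set n d (k \<otimes>\<^bsub>integer_group\<^esub> l) = bilinear_factor_set n d k
      \<otimes>\<^bsub>Z2b (C_brace n d) complex_units\<^esub> bilinear_factor_set n d l" for l
    unfolding bilinear_factor_set_def mult_Z2b
    by (auto simp: root_char_add distrib_right intro!: restrict_ext)
qed

text \<open>Trivial \<open>\<alpha>\<close> forces \<open>h\<close> to be a character
  \<open>e(ax)\<close>, whose circle coboundary is \<open>e(-ad xy)\<close>; comparison at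
  \<open>(1, 1)\<close> gives \<open>k = -ad\<close> modulo \<open>n\<close>.\<close>

lemma bilinear_factor_set_mem_B2b:
  assumes n: "n > 0" and "d dvd n" and brace: "skew_brace (C_brace n d)"
  shows "bilinear_factor_set n d k \<in> B2b (C_brace n d) complex_units \<longleftrightarrow> int d dvd k"
proof
  interpret skew_brace "C_brace n d"
    by (rule brace)
  have carrier: "carrier (C_brace n d) = {0..<int n}"
    by (rule carrier_C_brace[OF n])
  {
    assume "bilinear_factor_set n d k \<in> B2b (C_brace n d) complex_units"
    then obtain h where h_nz: "\<forall>x \<in> {0..<int n}. h x \<noteq> 0" and h0: "h 0 = 1"
      and h: "(\<lambda>u \<in> {0..<int n} \<times> {0..<int n}. 1) =
        (\<lambda>(x, y) \<in> {0..<int n} \<times> {0..<int n}. h y * inverse (h ((x + y) mod int n)) * h x)"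
        "(\<lambda>u \<in> {0..<int n} \<times> {0..<int n}. root_char n (k * (fst u * snd u))) =
        (\<lambda>(x, y) \<in> {0..<int n} \<times> {0..<int n}.
          h y * inverse (h ((x + y + int d * x * y) mod int n)) * h x)"
      unfolding mem_B2b bilinear_factor_set_def carrier by auto
    have h_add: "h ((x + y) mod int n) = h x * h y"
      if "x \<in> {0..<int n}" "y \<in> {0..<int n}" for x y
    proof -
      have "1 = h y * inverse (h ((x + y) mod int n)) * h x"
        using fun_cong[OF h(1), of "(x, y)"] that by simp
      moreover have "h ((x + y) mod int n) \<noteq> 0"
        using h_nz n by simp
      ultimately show ?thesis
        by (simp add: field_simps)
    qed
    obtain a where a: "\<And>x. x \<in> {0..<int n} \<Longrightarrow> h x = root_char n (a * x)"
      using character_of_cyclic_is_root_char[OF n h0 h_add] by blast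
    define u where "u = 1 mod int n"
    have u: "u \<in> {0..<int n}"
      using n by (simp add: u_def)
    have u2: "(u + u + int d * u * u) mod int n \<in> {0..<int n}"
      using n by simp
    have "root_char n (k * (u * u)) =
        h u * inverse (h ((u + u + int d * u * u) mod int n)) * h u"
      using fun_cong[OF h(2), of "(u, u)"] u by simp
    also have "\<dots> = root_char n (a * u - a * (u + u + int d * u * u) + a * u)"
      by (simp only: a[OF u] a[OF u2] root_char_mult_mod(1)[OF n] root_char_add root_char_diff)
    also have "\<dots> = root_char n (- (a * int d) * (u * u))"
      by (simp add: algebra_simps)
    finally have "root_char n k = root_char n (- (a * int d))"
      using n root_char_mult_mod(1)[OF n, of _ 1]
      by (simp only: u_def root_char_mult_mod mult_1_right)
    then have "int n dvd k + a * int d"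
      by (simp add: root_char_eq_iff[OF n] mod_eq_dvd_iff)
    \<comment> \<open>The congruence modulo \<open>n\<close> descends to one modulo
      \<open>d\<close>.\<close>
    with \<open>d dvd n\<close> have "int d dvd k + a * int d"
      by (meson dvd_trans int_dvd_int_iff)
    then show "int d dvd k"
      by (simp add: dvd_add_left_iff)
  next
    assume "int d dvd k"
    then obtain q where q: "k = int d * q" ..
    \<comment> \<open>The witness is \<open>h(x) = e(-qx)\<close>, obtained by solving
      \<open>k = -ad\<close> for \<open>a\<close>.\<close>
    have "1 = root_char n (- q * y) * inverse (root_char n (- q * (x + y))) * root_char n (- q * x)"
      for x y
      unfolding root_char_add[symmetric] root_char_minus[symmetric] by (simp add: algebra_simps)
    moreover have "root_char n (k * (x * y)) = root_char n (- q * y)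
        * inverse (root_char n (- q * (x + y + int d * x * y))) * root_char n (- q * x)" for x y
      unfolding root_char_add[symmetric] root_char_minus[symmetric] q by (simp add: algebra_simps)
    ultimately show "bilinear_factor_set n d k \<in> B2b (C_brace n d) complex_units"
      unfolding mem_B2b bilinear_factor_set_def using n
      by (intro exI[of _ "\<lambda>x. root_char n (- q * x)"])
        (auto simp only: C_brace_simps root_char_mult_mod root_char_nonzero mult_zero_right root_char_0
          fst_conv snd_conv prod.case intro!: restrict_ext)
  }
qed

lemma factor_set_C_brace_cohomologous_bilinear:
  assumes n: "n > 0" and primes: "\<forall>p::nat. Factorial_Ring.prime p \<and> p dvd n \<longrightarrow> p dvd d"
    and bicyclic: "bicyclic_skew_brace (C_brace n d)"
    and z: "z \<in> carrier (Z2b (C_brace n d) complex_units)"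
  shows "\<exists>b \<in> B2b (C_brace n d) complex_units. \<exists>c.
    z = b \<otimes>\<^bsub>Z2b (C_brace n d) complex_units\<^esub> bilinear_factor_set n d c"
proof -
  interpret bicyclic_skew_brace "C_brace n d"
    by (rule bicyclic)
  define S where "S = {0..<int n}"
  have carrier: "carrier (C_brace n d) = S"
    unfolding S_def by (rule carrier_C_brace[OF n])
  have mod_S: "x mod int n \<in> S" and S_0: "0 \<in> S" for x
    using n by (simp_all add: S_def)
  obtain \<alpha> \<mu> where z_eq: "z = (\<alpha>, \<mu>)"
    and ext: "\<alpha> \<in> extensional (S \<times> S)" "\<mu> \<in> extensional (S \<times> S)"
    and fs: "is_factor_set (C_brace n d) \<alpha> \<mu>"
    using z by (cases z) (auto simp: carrier_Z2b mem_factor_sets carrier)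
  obtain h where h0: "h 0 = 1" and h_nz: "\<And>x. x \<in> S \<Longrightarrow> h x \<noteq> 0"
    and h: "\<And>x y. \<lbrakk>x \<in> S; y \<in> S\<rbrakk> \<Longrightarrow> \<alpha> (x, y) = h y * inverse (h ((x + y) mod int n)) * h x"
    unfolding S_def
    by (rule cocycle_of_cyclic_is_coboundary[OF n, of \<alpha>])
      (use fs in \<open>auto simp: is_factor_set_def carrier S_def\<close>)
  \<comment> \<open>\<open>\<beta>\<close> and \<open>\<gamma>\<close> are the additive and circle
    coboundaries of \<open>h\<close>; dividing by them makes the additive component trivial.\<close>
  define \<beta> where "\<beta> = (\<lambda>(x, y). h y * inverse (h ((x + y) mod int n)) * h x)"
  define \<gamma> where "\<gamma> = (\<lambda>(x, y). h y * inverse (h ((x + y + int d * x * y) mod int n)) * h x)"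
  have \<gamma>_nz: "\<gamma> (x, y) \<noteq> 0" if "x \<in> S" "y \<in> S" for x y
    using that by (simp add: \<gamma>_def h_nz mod_S)
  have "is_factor_set (C_brace n d) \<beta> \<gamma>"
    using is_factor_set_coboundary[of h] h_nz h0 by (simp add: \<beta>_def \<gamma>_def carrier)
  then have "is_factor_set (C_brace n d) (\<lambda>u. \<alpha> u * inverse (\<beta> u)) (\<lambda>u. \<mu> u * inverse (\<gamma> u))"
    by (rule is_factor_set_mult[OF fs is_factor_set_inverse])
  moreover have "\<alpha> (x, y) * inverse (\<beta> (x, y)) = 1" if "x \<in> S" "y \<in> S" for x y
  proof -
    have "\<beta> (x, y) \<noteq> 0"
      using that by (simp add: \<beta>_def h_nz mod_S)
    moreover have "\<alpha> (x, y) = \<beta> (x, y)"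
      using that by (simp add: \<beta>_def h)
    ultimately show ?thesis
      by simp
  qed
  ultimately have fs1: "is_factor_set (C_brace n d) (\<lambda>u. 1) (\<lambda>u. \<mu> u * inverse (\<gamma> u))"
    using is_factor_set_cong[where \<alpha> = "\<lambda>u. \<alpha> u * inverse (\<beta> u)" and \<alpha>' = "\<lambda>u. 1"
        and \<mu> = "\<lambda>u. \<mu> u * inverse (\<gamma> u)" and \<mu>' = "\<lambda>u. \<mu> u * inverse (\<gamma> u)"]
    by (simp add: carrier)
  define \<nu> where "\<nu> x y = \<mu> (x, y) * inverse (\<gamma> (x, y))" for x y
  have \<nu>_0: "\<nu> x 0 = 1" if "x \<in> S" for x
    using fs1 that by (simp add: is_factor_set_def carrier \<nu>_def)
  \<comment> \<open>With trivial additive component, the mixed condition is precisely this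
    additivity.\<close>
  have \<nu>_add: "\<nu> x ((y + z) mod int n) = \<nu> x y * \<nu> x z" if "x \<in> S" "y \<in> S" "z \<in> S" for x y z
    using fs1 that by (simp add: is_factor_set_def carrier \<nu>_def)
  have \<nu>_cocycle: "\<nu> y z * \<nu> x ((y + z + int d * y * z) mod int n) =
      \<nu> ((x + y + int d * x * y) mod int n) z * \<nu> x y"
    if "x \<in> S" "y \<in> S" "z \<in> S" for x y z
    using fs1 that by (simp add: is_factor_set_def carrier \<nu>_def)
  have "\<exists>k. \<forall>y \<in> S. \<nu> x y = root_char n (k * y)" if x: "x \<in> S" for x
  proof -
    obtain k where "\<And>y. y \<in> {0..<int n} \<Longrightarrow> \<nu> x y = root_char n (k * y)"
      by (rule character_of_cyclic_is_root_char[of n "\<nu> x"])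
        (use n \<nu>_0[OF x] \<nu>_add[OF x] in \<open>simp_all add: S_def\<close>)
    then show ?thesis
      unfolding S_def by blast
  qed
  \<comment> \<open>Each \<open>f x\<close> is an arbitrary integer determined only modulo
    \<open>n\<close>, so later statements about \<open>f\<close> are congruences.\<close>
  then obtain f where f: "\<And>x y. \<lbrakk>x \<in> S; y \<in> S\<rbrakk> \<Longrightarrow> \<nu> x y = root_char n (f x * y)"
    by metis
  have f_crossed: "f ((x + y + int d * x * y) mod int n) mod int n = (f y + f x * (1 + int d * y)) mod int n"
    if xy: "x \<in> S" "y \<in> S" for x y
  proof -
    \<comment> \<open>The crossed relation results from the cocycle relation at
      \<open>(x, y, 1)\<close>, with \<open>u\<close> representing 1, by comparing
      exponents.\<close>
    define u where "u = 1 mod int n"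
    have u: "u \<in> S"
      by (simp add: u_def mod_S)
    define c where "c = (x + y + int d * x * y) mod int n"
    have "c \<in> S"
      by (simp add: c_def mod_S)
    have u_mult: "root_char n (k * u) = root_char n k" for k
      using root_char_mult_mod(1)[OF n, of k 1] by (simp add: u_def)
    have "root_char n (f y * u) * root_char n (f x * ((y + u + int d * y * u) mod int n)) =
        root_char n (f c * u) * root_char n (f x * y)"
      using \<nu>_cocycle[OF xy u] xy u \<open>c \<in> S\<close> by (simp add: f mod_S c_def)
    then have "root_char n (f y) * root_char n (f x * (y + u + int d * y * u)) =
        root_char n (f c) * root_char n (f x * y)"
      by (simp only: u_mult root_char_mult_mod(1)[OF n])
    moreover have "root_char n (f x * (y + u + int d * y * u)) =
        root_char n (f x * y + (f x * (1 + int d * y)) * u)"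
      by (simp add: algebra_simps)
    moreover have "\<dots> = root_char n (f x * y) * root_char n (f x * (1 + int d * y))"
      by (simp only: root_char_add u_mult)
    ultimately have "root_char n (f c) = root_char n (f y + f x * (1 + int d * y))"
      by (simp add: root_char_add mult_ac)
    then show ?thesis
      by (simp add: root_char_eq_iff[OF n] c_def)
  qed
  obtain c where c: "\<And>x. x \<in> S \<Longrightarrow> f x mod int n = (c * x) mod int n"
    unfolding S_def
    by (rule crossed_hom_C_brace_linear[OF n primes bicyclic, of f])
      (use f_crossed in \<open>simp_all add: S_def\<close>)
  have \<mu>: "\<mu> (x, y) = \<gamma> (x, y) * root_char n (c * (x * y))" if xy: "x \<in> S" "y \<in> S" for x y
  proof -
    have "root_char n (f x * y) = root_char n (c * x * y)"
      unfolding root_char_eq_iff[OF n] by (intro mod_mult_cong c xy refl)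
    with f[OF xy] \<gamma>_nz[OF xy] show ?thesis
      by (simp add: \<nu>_def field_simps)
  qed
  have "(restrict \<beta> (S \<times> S), restrict \<gamma> (S \<times> S)) \<in> B2b (C_brace n d) complex_units"
    unfolding mem_B2b carrier using h0 h_nz
    by (intro exI[of _ h]) (simp add: \<beta>_def \<gamma>_def)
  moreover have "z = (restrict \<beta> (S \<times> S), restrict \<gamma> (S \<times> S))
      \<otimes>\<^bsub>Z2b (C_brace n d) complex_units\<^esub> bilinear_factor_set n d c"
    unfolding z_eq bilinear_factor_set_def mult_Z2b carrier
    by (intro iffD2[OF prod.inject] conjI ext[THEN extensionalityI, OF restrict_extensional])
      (auto simp: h \<mu> \<beta>_def)
  ultimately show ?thesis
    by blast
qed

text \<open>The homomorphism \<open>bilinear_factor_set n d\<close> meets every class modulo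
  \<open>B2b\<close>, and the preimage of \<open>B2b\<close> consists of the multiples of
  \<open>d\<close>.\<close>

theorem schur_multiplier_C_brace:
  assumes n: "n > 0" and "d dvd n"
    and primes: "\<forall>p::nat. Factorial_Ring.prime p \<and> p dvd n \<longrightarrow> p dvd d"
    and bicyclic: "bicyclic_skew_brace (C_brace n d)"
  shows "integer_mod_group d \<cong> schur_multiplier (C_brace n d)"
proof -
  interpret bicyclic_skew_brace "C_brace n d"
    by (rule bicyclic)
  have "d > 0"
    using n \<open>d dvd n\<close> by (auto intro: Nat.gr0I)
  show ?thesis
    unfolding schur_multiplier_def H2b_def
  proof (rule comm_group.integer_mod_group_iso_FactGroup[OF comm_group_Z2b subgroup_B2b])
    show "bilinear_factor_set n d \<in> hom integer_group (Z2b (C_brace n d) complex_units)"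
      by (rule bilinear_factor_set_hom[OF n skew_brace_axioms])
    show "bilinear_factor_set n d k \<in> B2b (C_brace n d) complex_units \<longleftrightarrow> int d dvd k" for k
      by (rule bilinear_factor_set_mem_B2b[OF n \<open>d dvd n\<close> skew_brace_axioms])
  qed (fact \<open>d > 0\<close>, rule factor_set_C_brace_cohomologous_bilinear[OF n primes bicyclic])
qed

theorem proposition3p16:
  fixes n d :: nat
  assumes "n \<ge> 1"
    and "d dvd n"
    and "\<forall>p::nat. Factorial_Ring.prime p \<and> p dvd n \<longrightarrow> p dvd d"
    and "bicyclic_skew_brace (C_brace n d)"
  shows "is_schur_cover (C_brace (n * d) d) (C_brace n d)"
proof -
  have n: "n > 0"
    using assms(1) by simp
  have d: "d > 0"
    using n assms(2) by (auto intro: Nat.gr0I)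
  have extension: "annihilator_extension (integer_mod_group d) (\<lambda>k. int n * k)
      (C_brace (n * d) d) (\<lambda>x. x mod int n) (C_brace n d)"
    by (rule annihilator_extension_C_brace[OF n assms(2,3)])
  moreover have "(\<lambda>k. int n * k) ` carrier (integer_mod_group d)
      \<subseteq> brace_commutator (C_brace (n * d) d)"
  proof (intro image_subsetI)
    fix k assume "k \<in> carrier (integer_mod_group d)"
    then have k: "0 \<le> k" "k < int d"
      using d by (simp_all add: carrier_integer_mod_group)
    \<comment> \<open>Writing \<open>n = dm\<close> turns \<open>nk\<close> into
      \<open>d (mk)\<close>, a commutator; no reduction modulo \<open>nd\<close> occurs because
      \<open>k < d\<close>.\<close>
    obtain m where m: "int n = int d * m"
      using assms(2) by (metis dvd_def int_dvd_int_iff)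
    have "(int d * (m * k)) mod int (n * d) \<in> brace_commutator (C_brace (n * d) d)"
      using n d by (intro mult_mem_brace_commutator_C_brace) simp
    moreover have "(int d * (m * k)) mod int (n * d) = int n * k"
      using k n by (simp add: m[symmetric] mult.assoc[symmetric])
    ultimately show "int n * k \<in> brace_commutator (C_brace (n * d) d)"
      by simp
  qed
  moreover have "finite (carrier (C_brace n d))"
    using n by (simp add: carrier_C_brace)
  moreover have "skew_brace (C_brace (n * d) d)" "skew_brace (C_brace n d)"
    using extension by (simp_all add: annihilator_extension_def)
  moreover note schur_multiplier_C_brace[OF n assms(2-4)]
  ultimately show ?thesis
    unfolding is_schur_cover_def by (intro conjI exI)
qed

end
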